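(* Let $X=\{x_1,x_2,\dots,x_n\}$ be a finite set equipped with an arbitrary topology, let $\rho$ be a binary relation on $X$, and let $\mathcal F$ be a non-empty collection of subsets of $\mathbb N$. Let $[\rho]$ be the adjacency matrix of $\rho$ and let $a_{ij}^k$ denote the $(i,j)$ entry of the matrix power $[\rho]^k$. (i) For $1\le i\le n$, $x_i$ is an $\mathcal F$-hypercyclic vector for $\rho$ if and only if for every $k\in\mathbb N$ there exists a $\rho$-walk of length $k$ starting at $x_i$ and for each open non-empty subset $V$ of $X$ we have $\{k\in\mathbb N: a_{ij}^k\geq 1\text{ for some }j\text{ with }x_j\in V\}\in\mathcal F$. (ii) $\rho$ is $\mathcal F$-topologically transitive if and only if for each pair of open non-empty subsets $U,V$ of $X$ we have $\{k\in\mathbb N: a_{ij}^k\geq 1\text{ for some }i,j\text{ with }x_i\in U,\ x_j\in V\}\in\mathcal F$.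
   Context: $\mathbb N=\{1,2,3,\dots\}$. The adjacency matrix $[\rho]=[a_{ij}]_{1\le i,j\le n}$ has $a_{ij}=1$ if $(x_i,x_j)\in\rho$ and $a_{ij}=0$ otherwise. A $\rho$-walk of length $k\in\mathbb N$ starting at $x_{i_1}$ is a finite sequence $x_{i_1}x_{i_2}\cdots x_{i_{k+1}}$ with $(x_{i_j},x_{i_{j+1}})\in\rho$ for $1\le j\le k$. $\rho^k$ is the $k$-fold composition of $\rho$, $\rho^k x:=\{y:(x,y)\in\rho^k\}$, $\rho^k(U):=\bigcup_{x\in U}\rho^k x$, $D(\rho^k):=\{x:\rho^kx\neq\emptyset\}$, $D_\infty(\rho):=\bigcap_{k\in\mathbb N}D(\rho^k)$. An element $x\in X$ is an $\mathcal F$-hypercyclic vector (element) for $\rho$ if $x\in D_\infty(\rho)$ and for each non-empty open $V\subseteq X$, $\{k\in\mathbb N:\rho^k x\cap V\neq\emptyset\}\in\mathcal F$. $\rho$ is $\mathcal F$-topologically transitive if for all non-empty open $U,V\subseteq X$, $\{k\in\mathbb N:\rho^k(U)\cap V\neq\emptyset\}\in\mathcal F$. *)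

theory Defs
  imports "HOL-Analysis.Abstract_Topology" "Jordan_Normal_Form.Matrix"
begin

text \<open>
  The natural numbers of the source start at 1, so exponents and walk lengths range over
  \<open>{1..}\<close>. With \<open>\<rho>\<^sup>k\<close> being \<^term>\<open>\<rho> ^^ k\<close>, the sets \<open>\<rho>\<^sup>k x\<close> and \<open>\<rho>\<^sup>k(U)\<close> are the relational images
  \<^term>\<open>(\<rho> ^^ k) `` {x}\<close> and \<^term>\<open>(\<rho> ^^ k) `` U\<close>, and \<open>D(\<rho>\<^sup>k)\<close> is \<^term>\<open>Domain (\<rho> ^^ k)\<close>.
  The space \<open>X\<close> is \<^term>\<open>topspace T\<close>.
\<close>

definition D_infinity :: "'a rel \<Rightarrow> 'a set" where
  "D_infinity \<rho> = (\<Inter>k\<in>{1..}. Domain (\<rho> ^^ k))"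

definition hypercyclic_vector :: "nat set set \<Rightarrow> 'a topology \<Rightarrow> 'a rel \<Rightarrow> 'a \<Rightarrow> bool" where
  "hypercyclic_vector F T \<rho> x \<longleftrightarrow>
     x \<in> topspace T \<and> x \<in> D_infinity \<rho> \<and>
     (\<forall>V. openin T V \<and> V \<noteq> {} \<longrightarrow> {k \<in> {1..}. (\<rho> ^^ k) `` {x} \<inter> V \<noteq> {}} \<in> F)"

definition topologically_transitive :: "nat set set \<Rightarrow> 'a topology \<Rightarrow> 'a rel \<Rightarrow> bool" where
  "topologically_transitive F T \<rho> \<longleftrightarrow>
     (\<forall>U V. openin T U \<and> U \<noteq> {} \<and> openin T V \<and> V \<noteq> {} \<longrightarrow>
        {k \<in> {1..}. (\<rho> ^^ k) `` U \<inter> V \<noteq> {}} \<in> F)"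

text \<open>A walk of length \<open>k\<close> is the list of its \<open>k + 1\<close> vertices.\<close>

definition walk_from :: "'a rel \<Rightarrow> nat \<Rightarrow> 'a \<Rightarrow> 'a list \<Rightarrow> bool" where
  "walk_from \<rho> k x w \<longleftrightarrow>
     length w = k + 1 \<and> w ! 0 = x \<and> (\<forall>j<k. (w ! j, w ! (j + 1)) \<in> \<rho>)"

text \<open>
  Matrix indices start at 0, so the points are enumerated as \<open>x 0, \<dots>, x (n - 1)\<close>.
\<close>

definition adjacency_matrix :: "nat \<Rightarrow> (nat \<Rightarrow> 'a) \<Rightarrow> 'a rel \<Rightarrow> nat mat" where
  "adjacency_matrix n x \<rho> = mat n n (\<lambda>(i, j). if (x i, x j) \<in> \<rho> then 1 else 0)"

end

theory Submission
  imports Defs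
begin

text \<open>Entry \<open>(i, j)\<close> of the k-th power of the adjacency matrix counts the walks
  of length k from \<open>x i\<close> to \<open>x j\<close>, so it is positive exactly when
  \<open>(x i, x j)\<close> lies in \<open>\<rho> ^^ k\<close>.
  \<open>adjacency_matrix_pow_pos_iff\<close> proves this positivity statement, and
  \<open>ex_walk_from_iff\<close> identifies starting points of walks with the domain of
  \<open>\<rho> ^^ k\<close>. As x enumerates the whole space, both claims then follow because the
  sets of exponents on the two sides coincide, whatever the family F is.\<close>

lemma adjacency_matrix_carrier [simp]: "adjacency_matrix n x \<rho> \<in> carrier_mat n n"
  by (simp add: adjacency_matrix_def)

text \<open>Matrix multiplication mirrors relational composition: an entry of the next power sums
  over the last intermediate vertex. The endpoint j varies in the induction because the last step is
  split off.\<close>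

lemma adjacency_matrix_pow_pos_iff:
  assumes bij: "bij_betw x {..<n} S" and sub: "\<rho> \<subseteq> S \<times> S"
    and "i < n" "j < n"
  shows "(adjacency_matrix n x \<rho> ^\<^sub>m k) $$ (i, j) \<ge> 1 \<longleftrightarrow> (x i, x j) \<in> \<rho> ^^ k"
  using \<open>j < n\<close>
proof (induction k arbitrary: j)
  case 0
  \<comment> \<open>The zeroth power is the identity matrix and \<open>\<rho> ^^ 0\<close> is
    \<open>Id\<close>; they agree because x is injective.\<close>
  have "x i = x j \<longleftrightarrow> i = j"
    using bij \<open>i < n\<close> 0 by (auto simp: bij_betw_def inj_on_def)
  then show ?case
    using \<open>i < n\<close> 0 by (simp add: adjacency_matrix_def)
next
  case (Suc k)
  let ?A = "adjacency_matrix n x \<rho>"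
  have carr: "?A ^\<^sub>m k \<in> carrier_mat n n"
    by (rule pow_carrier_mat) simp
  have entry: "?A $$ (l, j) = (if (x l, x j) \<in> \<rho> then 1 else 0)" if "l < n" for l
    using that Suc.prems by (simp add: adjacency_matrix_def)
  have "(?A ^\<^sub>m Suc k) $$ (i, j) = (\<Sum>l<n. (?A ^\<^sub>m k) $$ (i, l) * ?A $$ (l, j))"
    using carrier_matD[OF carr] carrier_matD[OF adjacency_matrix_carrier[of n x \<rho>]]
      \<open>i < n\<close> Suc.prems
    by (auto simp: scalar_prod_def atLeast0LessThan intro!: sum.cong)
  \<comment> \<open>Entries are natural numbers, so nothing cancels: the sum is positive iff some
    summand is nonzero.\<close>
  then have "(?A ^\<^sub>m Suc k) $$ (i, j) \<ge> 1 \<longleftrightarrow>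
      (\<exists>l<n. (?A ^\<^sub>m k) $$ (i, l) * ?A $$ (l, j) \<noteq> 0)"
    by (auto simp: Suc_le_eq simp flip: neq0_conv)
  also have "\<dots> \<longleftrightarrow> (\<exists>l<n. (x i, x l) \<in> \<rho> ^^ k \<and> (x l, x j) \<in> \<rho>)"
    using Suc.IH by (auto simp: entry Suc_le_eq split: if_splits)
  also have "\<dots> \<longleftrightarrow> (x i, x j) \<in> \<rho> ^^ Suc k"
  proof -
    \<comment> \<open>The intermediate point is the source of a \<rho>-step, hence lies in S and has
      an index.\<close>
    have "\<exists>l<n. y = x l" if "(y, z) \<in> \<rho>" for y z
      using that sub bij by (force simp: bij_betw_def)
    then show ?thesis
      by (fastforce simp: relcomp_unfold)
  qed
  finally show ?case .
qed

text \<open>Both sides assert a chain of k steps from a: \<open>relpow_fun_conv\<close> gives it as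
  a function on the naturals, a walk as a list.\<close>

lemma ex_walk_from_iff: "(\<exists>w. walk_from \<rho> k a w) \<longleftrightarrow> a \<in> Domain (\<rho> ^^ k)"
proof
  assume "\<exists>w. walk_from \<rho> k a w"
  then obtain w where "w ! 0 = a" "\<forall>j<k. (w ! j, w ! Suc j) \<in> \<rho>"
    by (auto simp: walk_from_def)
  then have "(a, w ! k) \<in> \<rho> ^^ k"
    unfolding relpow_fun_conv by blast
  then show "a \<in> Domain (\<rho> ^^ k)" by blast
next
  assume "a \<in> Domain (\<rho> ^^ k)"
  then obtain f where "f 0 = a" "\<forall>j<k. (f j, f (Suc j)) \<in> \<rho>"
    by (auto simp: relpow_fun_conv)
  \<comment> \<open>The k steps of f visit the k + 1 vertices \<open>f 0\<close> to
    \<open>f k\<close>.\<close>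
  then have "walk_from \<rho> k a (map f [0..<k + 1])"
    by (simp add: walk_from_def nth_append del: upt_Suc)
  then show "\<exists>w. walk_from \<rho> k a w" ..
qed

theorem proposition3p3:
  fixes T :: "'a topology" and n :: nat and x :: "nat \<Rightarrow> 'a"
    and \<rho> :: "'a rel" and F :: "nat set set"
  assumes "n \<ge> 1"
    and "bij_betw x {..<n} (topspace T)"
    and "\<rho> \<subseteq> topspace T \<times> topspace T"
    and "F \<noteq> {}" and "F \<subseteq> Pow {1..}"
  shows "(\<forall>i<n. hypercyclic_vector F T \<rho> (x i) \<longleftrightarrow>
            (\<forall>k\<in>{1..}. \<exists>w. walk_from \<rho> k (x i) w) \<and>
            (\<forall>V. openin T V \<and> V \<noteq> {} \<longrightarrow>
               {k \<in> {1..}. \<exists>j<n. x j \<in> V \<and> (adjacency_matrix n x \<rho> ^\<^sub>m k) $$ (i, j) \<ge> 1} \<in> F))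
       \<and> (topologically_transitive F T \<rho> \<longleftrightarrow>
            (\<forall>U V. openin T U \<and> U \<noteq> {} \<and> openin T V \<and> V \<noteq> {} \<longrightarrow>
               {k \<in> {1..}. \<exists>i<n. \<exists>j<n. x i \<in> U \<and> x j \<in> V \<and>
                  (adjacency_matrix n x \<rho> ^\<^sub>m k) $$ (i, j) \<ge> 1} \<in> F))"
proof -
  let ?A = "adjacency_matrix n x \<rho>"
  note pos_iff = adjacency_matrix_pow_pos_iff[OF assms(2,3)]
  have x_in: "x i \<in> topspace T" if "i < n" for i
    using that assms(2) by (auto simp: bij_betw_def)
  \<comment> \<open>Open sets lie inside the space, so all their points are enumerated by x.\<close>
  have index: "\<exists>i<n. y = x i" if "openin T V" "y \<in> V" for y V
    using that assms(2) openin_subset by (fastforce simp: bij_betw_def)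
  have image: "(\<rho> ^^ k) `` {x i} \<inter> V \<noteq> {} \<longleftrightarrow> (\<exists>j<n. x j \<in> V \<and> (?A ^\<^sub>m k) $$ (i, j) \<ge> 1)"
    if "openin T V" "i < n" for i k V
  proof -
    have "(\<rho> ^^ k) `` {x i} \<inter> V \<noteq> {} \<longleftrightarrow> (\<exists>j<n. x j \<in> V \<and> (x i, x j) \<in> \<rho> ^^ k)"
      using index[OF that(1)] by blast
    then show ?thesis
      using pos_iff[OF that(2)] by auto
  qed
  have image': "(\<rho> ^^ k) `` U \<inter> V \<noteq> {} \<longleftrightarrow>
      (\<exists>i<n. \<exists>j<n. x i \<in> U \<and> x j \<in> V \<and> (?A ^\<^sub>m k) $$ (i, j) \<ge> 1)"
    if "openin T U" "openin T V" for k U V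
  proof -
    \<comment> \<open>The image of U is the union of the images of its points, which reduces the
      claim to \<open>image\<close>.\<close>
    have "(\<rho> ^^ k) `` U \<inter> V \<noteq> {} \<longleftrightarrow> (\<exists>i<n. x i \<in> U \<and> (\<rho> ^^ k) `` {x i} \<inter> V \<noteq> {})"
      using index[OF that(1)] by blast
    then show ?thesis
      using image[OF that(2)] by blast
  qed
  have "hypercyclic_vector F T \<rho> (x i) \<longleftrightarrow>
      (\<forall>k\<in>{1..}. \<exists>w. walk_from \<rho> k (x i) w) \<and>
      (\<forall>V. openin T V \<and> V \<noteq> {} \<longrightarrow>
         {k \<in> {1..}. \<exists>j<n. x j \<in> V \<and> (?A ^\<^sub>m k) $$ (i, j) \<ge> 1} \<in> F)" if "i < n" for i
    using x_in[OF that] image[OF _ that]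
    \<comment> \<open>The congruence rules make openness of V available when the set of exponents is
      rewritten with \<open>image\<close>.\<close>
    by (simp add: hypercyclic_vector_def D_infinity_def ex_walk_from_iff cong: conj_cong imp_cong)
  moreover have "topologically_transitive F T \<rho> \<longleftrightarrow>
      (\<forall>U V. openin T U \<and> U \<noteq> {} \<and> openin T V \<and> V \<noteq> {} \<longrightarrow>
         {k \<in> {1..}. \<exists>i<n. \<exists>j<n. x i \<in> U \<and> x j \<in> V \<and> (?A ^\<^sub>m k) $$ (i, j) \<ge> 1} \<in> F)"
    by (simp add: topologically_transitive_def image' cong: conj_cong imp_cong)
  ultimately show ?thesis by blast
qed

end
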